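(* Let $t$ be a positive integer. For any graph $G$ and any set $\mathcal{F}$ of graphs, \[\iota(G,\mathcal{F}) - (t-1)\gamma(\mathcal{F}) \leq \iota(G,t\mathcal{F}) \leq \iota(G,\mathcal{F}).\] Moreover, for any integers $k \geq 1$ and $q \geq 1$, there exist two graphs $G$ and $H$ such that \[\iota(G, tK_k) = \iota(G, K_k) = \gamma(G) = q = \iota(H, tK_k) = \iota(H, K_k) - (t-1)\gamma(K_k)\] and $\iota(H, K_k) = \gamma(H)$.
   Context: Graphs are finite, simple and undirected, with non-empty vertex set (except that deleting vertices may yield the null graph). For a graph $G$ and $D \subseteq V(G)$, $N[D]$ denotes the closed neighbourhood of $D$ in $G$. $\gamma(G)$ is the domination number of $G$: the smallest size of a set $D \subseteq V(G)$ with $N[D] = V(G)$. For a set $\mathcal{F}$ of graphs, an $\mathcal{F}$-graph is a graph isomorphic to a member of $\mathcal{F}$. A graph contains an $\mathcal{F}$-graph if it has a (not necessarily induced) subgraph that is an $\mathcal{F}$-graph. A set $D \subseteq V(G)$ is an $\mathcal{F}$-isolating set of $G$ if $G - N[D]$ contains no $\mathcal{F}$-graph, and $\iota(G,\mathcal{F})$ denotes the size of a smallest $\mathcal{F}$-isolating set of $G$. For a positive integer $t$, \[t\mathcal{F} = \{F_1 \cup \dots \cup F_t \colon F_1, \dots, F_t \mbox{ are pairwise vertex-disjoint } \mathcal{F}\mbox{-graphs}\}.\] If $\mathcal{F} = \{F\}$, one writes $\iota(G,F)$ for $\iota(G,\mathcal{F})$ and $tF$ for $t\mathcal{F}$. $\gamma(\mathcal{F})$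 denotes $\max\{\gamma(F) \colon F \in \mathcal{F}\}$ (it is presupposed that this maximum exists). $K_k$ is the complete graph on $k$ vertices. *)

theory Defs
  imports "Graph_Theory.Graph_Theory" "HOL-Library.Infinite_Typeclass"
begin

text \<open>
  A finite simple undirected graph is a finite, loop-free, symmetric digraph whose arcs are pairs of
  vertices: the edge \<open>uv\<close> is the pair of arcs \<open>(u, v)\<close>, \<open>(v, u)\<close>. The locale
  \<^locale>\<open>pair_graph\<close> still admits the null graph. Between graphs of the form
  \<^term>\<open>with_proj G\<close> the relation \<^const>\<open>digraph_iso\<close> is ordinary graph isomorphism, since the
  action on arcs is determined by the action on vertices.
\<close>

definition simple_graph :: "'a pair_pre_digraph \<Rightarrow> bool" where
  "simple_graph G \<longleftrightarrow> pair_graph G \<and> pverts G \<noteq> {}"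

definition closed_nbhd :: "'a pair_pre_digraph \<Rightarrow> 'a set \<Rightarrow> 'a set" where
  "closed_nbhd G D = D \<union> {v. \<exists>u\<in>D. (u, v) \<in> parcs G}"

definition domination_number :: "'a pair_pre_digraph \<Rightarrow> nat" where
  "domination_number G =
    (LEAST n. \<exists>D \<subseteq> pverts G. closed_nbhd G D = pverts G \<and> card D = n)"

definition is_family_graph :: "'b pair_pre_digraph set \<Rightarrow> 'a pair_pre_digraph \<Rightarrow> bool" where
  "is_family_graph \<F> H \<longleftrightarrow> (\<exists>F\<in>\<F>. digraph_iso (with_proj F) (with_proj H))"

definition contains_family_graph ::
    "'b pair_pre_digraph set \<Rightarrow> ('a, 'a \<times> 'a) pre_digraph \<Rightarrow> bool" where
  "contains_family_graph \<F> G \<longleftrightarrow>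
    (\<exists>H :: 'a pair_pre_digraph. subgraph (with_proj H) G \<and> is_family_graph \<F> H)"

definition isolating_set ::
    "'b pair_pre_digraph set \<Rightarrow> 'a pair_pre_digraph \<Rightarrow> 'a set \<Rightarrow> bool" where
  "isolating_set \<F> G D \<longleftrightarrow> D \<subseteq> pverts G \<and>
    \<not> contains_family_graph \<F> (with_proj G \<restriction> (pverts G - closed_nbhd G D))"

definition isolation_number :: "'a pair_pre_digraph \<Rightarrow> 'b pair_pre_digraph set \<Rightarrow> nat" where
  "isolation_number G \<F> = (LEAST n. \<exists>D. isolating_set \<F> G D \<and> card D = n)"

text \<open>
  The vertex type is required to be infinite so that there is always room for \<open>t\<close> pairwise
  vertex-disjoint copies of members of the family.
\<close>

definition disjoint_copies ::
    "nat \<Rightarrow> 'b::infinite pair_pre_digraph set \<Rightarrow> 'b pair_pre_digraph set" where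
  "disjoint_copies t \<F> =
    {\<lparr> pverts = (\<Union>i<t. pverts (H i)), parcs = (\<Union>i<t. parcs (H i)) \<rparr> | H.
      (\<forall>i<t. is_family_graph \<F> (H i)) \<and>
      (\<forall>i<t. \<forall>j<t. i \<noteq> j \<longrightarrow> pverts (H i) \<inter> pverts (H j) = {})}"

text \<open>Only meaningful if the maximum exists; \<^const>\<open>Max\<close> is unspecified otherwise.\<close>

definition has_max_domination_number :: "'b pair_pre_digraph set \<Rightarrow> bool" where
  "has_max_domination_number \<F> \<longleftrightarrow>
    (\<exists>F\<^sub>0\<in>\<F>. \<forall>F\<in>\<F>. domination_number F \<le> domination_number F\<^sub>0)"

definition family_domination_number :: "'b pair_pre_digraph set \<Rightarrow> nat" where
  "family_domination_number \<F> = Max (domination_number ` \<F>)"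

definition complete_graph :: "nat \<Rightarrow> nat pair_pre_digraph" where
  "complete_graph k = \<lparr> pverts = {..<k}, parcs = {(u, v). u < k \<and> v < k \<and> u \<noteq> v} \<rparr>"

lemma complete_graph_complete: "K\<^bsub>k\<^esub> (with_proj (complete_graph k))"
  by (auto simp: complete_digraph_pair_def complete_graph_def)

end

theory Submission
  imports Defs
begin

text \<open>
  The condition that \<open>G - N[D]\<close> contains a \<open>t\<F>\<close>-graph means that \<open>G - N[D]\<close> contains \<open>t\<close> pairwise
  disjoint \<open>\<F>\<close>-graphs (\<open>contains_disjoint_copies_iff\<close>); this packing formulation is used throughout.
  A graph that has no \<open>\<F>\<close>-subgraph certainly has no \<open>t\<close> disjoint ones, which is the upper bound.

  For the lower bound, let \<open>D\<close> be a smallest \<open>t\<F>\<close>-isolating set. As long as \<open>G - N[D]\<close> still contains an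
  \<open>\<F>\<close>-graph \<open>H\<close>, enlarge \<open>D\<close> by a dominating set of \<open>H\<close>, that is, by at most \<open>\<gamma>(\<F>)\<close> vertices. All of \<open>H\<close>
  then lies in \<open>N[D]\<close>, so the copies removed in successive rounds are pairwise disjoint, and there are
  at most \<open>t - 1\<close> rounds (\<open>isolating_set_from_packing_bound\<close>).

  Sharpness is witnessed by disjoint unions of complete graphs. In a union of \<open>m\<close> copies of \<open>K\<^bsub>ak\<^esub>\<close>, a
  vertex of \<open>D\<close> removes exactly its own component, and each component that avoids \<open>D\<close> holds exactly \<open>a\<close>
  disjoint copies of \<open>K\<^sub>k\<close>. Hence \<open>\<iota>(\<sqdot>, tK\<^sub>k)\<close> is the least \<open>d\<close> with \<open>(m - d)a < t\<close>
  (\<open>isolation_number_disjoint_complete\<close>), whereas the domination number is \<open>m\<close>. The choice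
  \<open>m = q\<close>, \<open>a = t\<close> yields \<open>G\<close>: there \<open>\<iota>(G, tK\<^sub>k) = q = \<gamma>(G)\<close>, and \<open>\<iota>(G, K\<^sub>k)\<close> lies between the two. The choice
  \<open>m = q + t - 1\<close>, \<open>a = 1\<close> yields \<open>H\<close>: there \<open>\<iota>(H, tK\<^sub>k) = q\<close>, while the same formula with one copy instead
  of \<open>t\<close> gives \<open>\<iota>(H, K\<^sub>k) = q + t - 1 = \<gamma>(H)\<close>.
\<close>

section \<open>Copies of family graphs\<close>

definition graph_image :: "('a \<Rightarrow> 'b) \<Rightarrow> 'a pair_pre_digraph \<Rightarrow> 'b pair_pre_digraph" where
  "graph_image f F = \<lparr> pverts = f ` pverts F, parcs = map_prod f f ` parcs F \<rparr>"

lemma graph_image_simps [simp]: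
  "pverts (graph_image f F) = f ` pverts F"
  "parcs (graph_image f F) = map_prod f f ` parcs F"
  by (simp_all add: graph_image_def)

lemma graph_image_comp: "graph_image g (graph_image f F) = graph_image (g \<circ> f) F"
  by (auto simp: graph_image_def image_image map_prod.comp[symmetric] image_comp)

lemma graph_image_inverse:
  assumes "pair_wf_digraph F" and inv: "\<And>v. v \<in> pverts F \<Longrightarrow> g (f v) = v"
  shows "graph_image g (graph_image f F) = F"
proof -
  interpret pair_wf_digraph F by fact
  have "map_prod (g \<circ> f) (g \<circ> f) e = e" if "e \<in> parcs F" for e
    using that by (cases e) (auto simp: inv dest: in_arcsD1 in_arcsD2)
  then have "map_prod (g \<circ> f) (g \<circ> f) ` parcs F = parcs F"
    by simp
  moreover have "(g \<circ> f) ` pverts F = pverts F"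
    using inv by simp
  ultimately show ?thesis
    unfolding graph_image_comp by (simp add: graph_image_def)
qed

lemma pair_wf_digraph_graph_image:
  "pair_wf_digraph F \<Longrightarrow> pair_wf_digraph (graph_image f F)"
  unfolding pair_wf_digraph_def by force

text \<open>
  An isomorphism record also carries an action on arcs. Since the projections are \<^const>\<open>fst\<close> and
  \<^const>\<open>snd\<close> on both sides, this action is forced to be the componentwise action on vertices.
\<close>

lemma digraph_iso_with_proj_iff:
  fixes F :: "'b pair_pre_digraph" and H :: "'a pair_pre_digraph"
  shows "digraph_iso (with_proj F) (with_proj H) \<longleftrightarrow>
    pair_wf_digraph F \<and> (\<exists>f. inj_on f (pverts F) \<and> H = graph_image f F)"
proof
  assume "digraph_iso (with_proj F) (with_proj H)"
  then obtain h where h: "pre_digraph.digraph_isomorphism (with_proj F) h"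
    and H: "with_proj H = app_iso h (with_proj F)"
    unfolding digraph_iso_def by blast
  let ?f = "iso_verts h"
  have wf: "pair_wf_digraph F" and inj: "inj_on ?f (pverts F)"
    using h by (auto simp: pre_digraph.digraph_isomorphism_def wf_digraph_wp_iff)
  have proj: "iso_tail h = fst" "iso_head h = snd"
    using arg_cong[OF H, of tail] arg_cong[OF H, of head] by simp_all
  have arcs: "iso_arcs h e = map_prod ?f ?f e" if "e \<in> parcs F" for e
    using h that by (auto simp: pre_digraph.digraph_isomorphism_def proj prod_eq_iff)
  have "pverts H = ?f ` pverts F"
    using arg_cong[OF H, of verts] by simp
  moreover have "parcs H = map_prod ?f ?f ` parcs F"
    using arg_cong[OF H, of arcs] arcs by (simp cong: image_cong)
  ultimately have "H = graph_image ?f F"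
    by (simp add: graph_image_def)
  with wf inj show "pair_wf_digraph F \<and> (\<exists>f. inj_on f (pverts F) \<and> H = graph_image f F)"
    by blast
next
  assume "pair_wf_digraph F \<and> (\<exists>f. inj_on f (pverts F) \<and> H = graph_image f F)"
  then obtain f where wf: "pair_wf_digraph F" and inj: "inj_on f (pverts F)"
    and H: "H = graph_image f F" by blast
  interpret pair_wf_digraph F by fact
  define h where "h = \<lparr> iso_verts = f, iso_arcs = map_prod f f, iso_head = snd, iso_tail = fst \<rparr>"
  have "parcs F \<subseteq> pverts F \<times> pverts F"
    using arc_fst_in_verts arc_snd_in_verts by force
  then have "inj_on (map_prod f f) (parcs F)"
    using map_prod_inj_on[OF inj inj] inj_on_subset by blast
  then have "pre_digraph.digraph_isomorphism (with_proj F) h"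
    using inj wf by (auto simp: pre_digraph.digraph_isomorphism_def h_def wf_digraph_wp_iff)
  moreover have "with_proj H = app_iso h (with_proj F)"
    by (simp add: with_proj_def app_iso_def h_def H)
  ultimately show "digraph_iso (with_proj F) (with_proj H)"
    unfolding digraph_iso_def by blast
qed

lemma is_family_graph_iff:
  "is_family_graph \<F> H \<longleftrightarrow>
    (\<exists>F\<in>\<F>. pair_wf_digraph F \<and> (\<exists>f. inj_on f (pverts F) \<and> H = graph_image f F))"
  by (simp add: is_family_graph_def digraph_iso_with_proj_iff)

lemma is_family_graph_wf: "is_family_graph \<F> H \<Longrightarrow> pair_wf_digraph H"
  by (auto simp: is_family_graph_iff pair_wf_digraph_graph_image)

lemma is_family_graph_graph_image:
  assumes "is_family_graph \<F> H" "inj_on g (pverts H)"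
  shows "is_family_graph \<F> (graph_image g H)"
proof -
  obtain F f where F: "F \<in> \<F>" "pair_wf_digraph F" "inj_on f (pverts F)" "H = graph_image f F"
    using assms(1) by (auto simp: is_family_graph_iff)
  then have "inj_on (g \<circ> f) (pverts F)"
    using assms(2) by (simp add: comp_inj_on)
  with F show ?thesis
    unfolding is_family_graph_iff by (metis graph_image_comp)
qed

lemma is_family_graph_nonempty:
  "is_family_graph \<F> H \<Longrightarrow> \<forall>F\<in>\<F>. simple_graph F \<Longrightarrow> pverts H \<noteq> {}"
  by (auto simp: is_family_graph_iff simple_graph_def)

section \<open>Packings of family graphs\<close>

definition family_packing ::
    "nat \<Rightarrow> 'b pair_pre_digraph set \<Rightarrow> 'a pair_pre_digraph \<Rightarrow> 'a set \<Rightarrow> bool" where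
  "family_packing n \<F> G S \<longleftrightarrow> (\<exists>H.
    (\<forall>i<n. is_family_graph \<F> (H i) \<and> pverts (H i) \<subseteq> S \<and> parcs (H i) \<subseteq> parcs G) \<and>
    (\<forall>i<n. \<forall>j<n. i \<noteq> j \<longrightarrow> pverts (H i) \<inter> pverts (H j) = {}))"

lemma family_packing_one:
  "family_packing 1 \<F> G S \<longleftrightarrow>
    (\<exists>H. is_family_graph \<F> H \<and> pverts H \<subseteq> S \<and> parcs H \<subseteq> parcs G)"
  unfolding family_packing_def by auto

lemma family_packing_mono:
  "family_packing n \<F> G S \<Longrightarrow> m \<le> n \<Longrightarrow> S \<subseteq> T \<Longrightarrow> family_packing m \<F> G T"
proof -
  assume "family_packing n \<F> G S" "m \<le> n" "S \<subseteq> T"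
  then obtain H where
    "\<forall>i<n. is_family_graph \<F> (H i) \<and> pverts (H i) \<subseteq> S \<and> parcs (H i) \<subseteq> parcs G"
    "\<forall>i<n. \<forall>j<n. i \<noteq> j \<longrightarrow> pverts (H i) \<inter> pverts (H j) = {}"
    unfolding family_packing_def by blast
  then have "\<forall>i<m. is_family_graph \<F> (H i) \<and> pverts (H i) \<subseteq> T \<and> parcs (H i) \<subseteq> parcs G"
    and "\<forall>i<m. \<forall>j<m. i \<noteq> j \<longrightarrow> pverts (H i) \<inter> pverts (H j) = {}"
    using \<open>m \<le> n\<close> \<open>S \<subseteq> T\<close> by (meson order_less_le_trans subset_trans)+
  then show ?thesis
    unfolding family_packing_def by blast
qed

lemma family_packing_Suc:
  assumes "is_family_graph \<F> H" "pverts H \<subseteq> S" "parcs H \<subseteq> parcs G"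
    and "family_packing n \<F> G T" "T \<subseteq> S - pverts H"
  shows "family_packing (Suc n) \<F> G S"
proof -
  obtain H' where
    H': "\<forall>i<n. is_family_graph \<F> (H' i) \<and> pverts (H' i) \<subseteq> T \<and> parcs (H' i) \<subseteq> parcs G"
    and disj: "\<forall>i<n. \<forall>j<n. i \<noteq> j \<longrightarrow> pverts (H' i) \<inter> pverts (H' j) = {}"
    using assms(4) unfolding family_packing_def by blast
  have apart: "pverts (H' i) \<inter> pverts H = {}" if "i < n" for i
    using H' that assms(5) by blast
  let ?H = "H'(n := H)"
  have "\<forall>i<Suc n. is_family_graph \<F> (?H i) \<and> pverts (?H i) \<subseteq> S \<and> parcs (?H i) \<subseteq> parcs G"
    using H' assms(1-3,5) by (auto simp: less_Suc_eq) blast+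
  moreover have "\<forall>i<Suc n. \<forall>j<Suc n. i \<noteq> j \<longrightarrow> pverts (?H i) \<inter> pverts (?H j) = {}"
    using disj apart by (auto simp: less_Suc_eq Int_commute)
  ultimately show ?thesis
    unfolding family_packing_def by blast
qed

lemma subgraph_induce_subgraph_iff:
  "subgraph (with_proj H) (with_proj G \<restriction> S) \<longleftrightarrow>
    pair_wf_digraph H \<and> pverts H \<subseteq> S \<and> parcs H \<subseteq> parcs G"
proof -
  have "wf_digraph (with_proj G \<restriction> S)"
    by unfold_locales auto
  moreover have "parcs H \<subseteq> {e \<in> parcs G. fst e \<in> S \<and> snd e \<in> S}"
    if "pair_wf_digraph H" "pverts H \<subseteq> S" "parcs H \<subseteq> parcs G"
    using that unfolding pair_wf_digraph_def by blast
  ultimately show ?thesis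
    by (auto simp: subgraph_def compatible_def wf_digraph_wp_iff)
qed

lemma contains_family_graph_iff:
  "contains_family_graph \<F> (with_proj G \<restriction> S) \<longleftrightarrow> family_packing 1 \<F> G S"
  unfolding contains_family_graph_def family_packing_one subgraph_induce_subgraph_iff
  using is_family_graph_wf by blast

text \<open>
  The family \<^term>\<open>disjoint_copies n \<F>\<close> lives on the vertex type of \<open>\<F>\<close> and not on that of \<open>G\<close>. The
  copies found in \<open>G\<close> together have only finitely many vertices, so they can be carried over into that
  infinite type by one common injection, which preserves their disjointness.
\<close>

lemma contains_disjoint_copies_iff:
  fixes G :: "'a pair_pre_digraph" and \<F> :: "'b::infinite pair_pre_digraph set"
  assumes "finite S"
  shows "contains_family_graph (disjoint_copies n \<F>) (with_proj G \<restriction> S) \<longleftrightarrow>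
    family_packing n \<F> G S"
proof
  assume "contains_family_graph (disjoint_copies n \<F>) (with_proj G \<restriction> S)"
  then obtain K where "is_family_graph (disjoint_copies n \<F>) K"
    and KS: "pverts K \<subseteq> S" "parcs K \<subseteq> parcs G"
    unfolding contains_family_graph_iff family_packing_one by blast
  then obtain U f where "U \<in> disjoint_copies n \<F>" and inj: "inj_on f (pverts U)"
    and K: "K = graph_image f U"
    unfolding is_family_graph_iff by blast
  then obtain H where
    U: "U = \<lparr> pverts = (\<Union>i<n. pverts (H i)), parcs = (\<Union>i<n. parcs (H i)) \<rparr>"
    and fam: "\<forall>i<n. is_family_graph \<F> (H i)"
    and disj: "\<forall>i<n. \<forall>j<n. i \<noteq> j \<longrightarrow> pverts (H i) \<inter> pverts (H j) = {}"
    unfolding disjoint_copies_def by blast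
  let ?H = "\<lambda>i. graph_image f (H i)"
  have sub: "pverts (H i) \<subseteq> pverts U" "parcs (H i) \<subseteq> parcs U" if "i < n" for i
    using that by (auto simp: U)
  have "is_family_graph \<F> (?H i) \<and> pverts (?H i) \<subseteq> S \<and> parcs (?H i) \<subseteq> parcs G" if "i < n" for i
  proof (intro conjI)
    show "is_family_graph \<F> (?H i)"
      using fam inj sub that by (blast intro: is_family_graph_graph_image inj_on_subset)
    show "pverts (?H i) \<subseteq> S"
      using KS(1) sub(1)[OF that] by (auto simp: K)
    show "parcs (?H i) \<subseteq> parcs G"
      using KS(2) image_mono[OF sub(2)[OF that], of "map_prod f f"] by (simp add: K)
  qed
  moreover have "pverts (?H i) \<inter> pverts (?H j) = {}" if "i < n" "j < n" "i \<noteq> j" for i j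
    using disj that inj_on_image_Int[OF inj sub(1) sub(1), of i j] by simp
  ultimately show "family_packing n \<F> G S"
    unfolding family_packing_def by (intro exI[of _ ?H]) blast
next
  assume "family_packing n \<F> G S"
  then obtain H where
    H: "\<forall>i<n. is_family_graph \<F> (H i) \<and> pverts (H i) \<subseteq> S \<and> parcs (H i) \<subseteq> parcs G"
    and disj: "\<forall>i<n. \<forall>j<n. i \<noteq> j \<longrightarrow> pverts (H i) \<inter> pverts (H j) = {}"
    unfolding family_packing_def by blast
  obtain e :: "'a \<Rightarrow> 'b" where e: "inj_on e S"
    using assms infinite_UNIV by (metis inj_on_iff_card_le infinite_arbitrarily_large order_refl)
  define K where "K = \<lparr> pverts = (\<Union>i<n. pverts (H i)), parcs = (\<Union>i<n. parcs (H i)) \<rparr>"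
  have wf: "pair_wf_digraph K"
    using H is_family_graph_wf unfolding K_def pair_wf_digraph_def by fastforce
  have KS: "pverts K \<subseteq> S" "parcs K \<subseteq> parcs G"
    using H by (auto simp: K_def)
  let ?U = "graph_image e K"
  have "?U = \<lparr> pverts = (\<Union>i<n. pverts (graph_image e (H i))),
      parcs = (\<Union>i<n. parcs (graph_image e (H i))) \<rparr>"
    by (simp add: graph_image_def K_def image_UN)
  moreover have "\<forall>i<n. is_family_graph \<F> (graph_image e (H i))"
    using H e by (blast intro: is_family_graph_graph_image inj_on_subset)
  moreover have "pverts (graph_image e (H i)) \<inter> pverts (graph_image e (H j)) = {}"
    if "i < n" "j < n" "i \<noteq> j" for i j
    using disj that H inj_on_image_Int[OF e, of "pverts (H i)" "pverts (H j)"] by simp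
  ultimately have "?U \<in> disjoint_copies n \<F>"
    unfolding disjoint_copies_def mem_Collect_eq
    by (intro exI[of _ "\<lambda>i. graph_image e (H i)"] conjI) simp_all
  moreover have "K = graph_image (the_inv_into S e) ?U"
    using KS(1) e by (subst graph_image_inverse[OF wf]) (auto simp: the_inv_into_f_f)
  moreover have "inj_on (the_inv_into S e) (pverts ?U)"
    using inj_on_the_inv_into[OF e] KS(1) by (auto intro: inj_on_subset)
  ultimately have "is_family_graph (disjoint_copies n \<F>) K"
    unfolding is_family_graph_iff using pair_wf_digraph_graph_image[OF wf] by blast
  with KS show "contains_family_graph (disjoint_copies n \<F>) (with_proj G \<restriction> S)"
    unfolding contains_family_graph_iff family_packing_one by blast
qed

section \<open>Isolating and dominating sets\<close>

lemma simple_graph_finite: "simple_graph G \<Longrightarrow> finite (pverts G)"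
  by (simp add: simple_graph_def pair_graph_def pair_digraph_def pair_fin_digraph_def
      pair_fin_digraph_axioms_def)

lemma simple_graph_wf: "simple_graph G \<Longrightarrow> pair_wf_digraph G"
  by (simp add: simple_graph_def pair_graph_def pair_digraph_def pair_fin_digraph_def)

lemma isolating_set_iff:
  "isolating_set \<F> G D \<longleftrightarrow>
    D \<subseteq> pverts G \<and> \<not> family_packing 1 \<F> G (pverts G - closed_nbhd G D)"
  by (simp add: isolating_set_def contains_family_graph_iff)

lemma isolating_set_disjoint_copies_iff:
  fixes \<F> :: "'b::infinite pair_pre_digraph set"
  assumes "finite (pverts G)"
  shows "isolating_set (disjoint_copies t \<F>) G D \<longleftrightarrow>
    D \<subseteq> pverts G \<and> \<not> family_packing t \<F> G (pverts G - closed_nbhd G D)"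
  using assms by (simp add: isolating_set_def contains_disjoint_copies_iff)

lemma isolation_number_le: "isolating_set \<F> G D \<Longrightarrow> isolation_number G \<F> \<le> card D"
  unfolding isolation_number_def by (rule Least_le) blast

lemma isolation_number_attained:
  assumes "isolating_set \<F> G D"
  obtains D' where "isolating_set \<F> G D'" "card D' = isolation_number G \<F>"
  using LeastI[of "\<lambda>n. \<exists>D. isolating_set \<F> G D \<and> card D = n" "card D"] assms
  unfolding isolation_number_def by blast

lemma isolation_number_disjoint_copies_one:
  fixes \<F> :: "'b::infinite pair_pre_digraph set"
  assumes "finite (pverts G)"
  shows "isolation_number G (disjoint_copies 1 \<F>) = isolation_number G \<F>"
  by (simp only: isolation_number_def isolating_set_iff[of \<F>]
      isolating_set_disjoint_copies_iff[OF assms])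

lemma closed_nbhd_verts: "pair_wf_digraph G \<Longrightarrow> closed_nbhd G (pverts G) = pverts G"
  unfolding closed_nbhd_def pair_wf_digraph_def by force

lemma closed_nbhd_mono: "D \<subseteq> E \<Longrightarrow> closed_nbhd G D \<subseteq> closed_nbhd G E"
  unfolding closed_nbhd_def by blast

lemma domination_number_le:
  "D \<subseteq> pverts G \<Longrightarrow> closed_nbhd G D = pverts G \<Longrightarrow> domination_number G \<le> card D"
  unfolding domination_number_def by (rule Least_le) blast

lemma domination_number_attained:
  assumes "pair_wf_digraph G"
  obtains D where "D \<subseteq> pverts G" "closed_nbhd G D = pverts G" "card D = domination_number G"
  using LeastI[of "\<lambda>n. \<exists>D \<subseteq> pverts G. closed_nbhd G D = pverts G \<and> card D = n"
      "card (pverts G)"] closed_nbhd_verts[OF assms]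
  unfolding domination_number_def by blast

lemma isolating_set_of_dominating:
  assumes "\<forall>F\<in>\<F>. simple_graph F" "D \<subseteq> pverts G" "closed_nbhd G D = pverts G"
  shows "isolating_set \<F> G D"
  using assms is_family_graph_nonempty unfolding isolating_set_iff family_packing_one by fastforce

lemma isolation_number_le_domination_number:
  assumes "simple_graph G" "\<forall>F\<in>\<F>. simple_graph F"
  shows "isolation_number G \<F> \<le> domination_number G"
  using domination_number_attained[OF simple_graph_wf[OF assms(1)]]
    isolating_set_of_dominating[OF assms(2)] isolation_number_le by metis

lemma family_graph_dominating_set:
  assumes "is_family_graph \<F> H" "\<forall>F\<in>\<F>. domination_number F \<le> g"
  obtains D where "D \<subseteq> pverts H" "pverts H \<subseteq> closed_nbhd H D" "card D \<le> g"
proof -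
  obtain F f where F: "F \<in> \<F>" "pair_wf_digraph F" "inj_on f (pverts F)" "H = graph_image f F"
    using assms(1) by (auto simp: is_family_graph_iff)
  obtain D where D: "D \<subseteq> pverts F" "closed_nbhd F D = pverts F" "card D = domination_number F"
    using domination_number_attained F(2) by blast
  show ?thesis
  proof
    show "f ` D \<subseteq> pverts H"
      using D F by auto
    show "pverts H \<subseteq> closed_nbhd H (f ` D)"
      using D(2) unfolding F(4) closed_nbhd_def by (force simp: image_iff)
    show "card (f ` D) \<le> g"
      using card_image[of f D] F D assms(2) by (metis inj_on_subset)
  qed
qed

section \<open>The two bounds\<close>

lemma isolation_number_disjoint_copies_le:
  fixes \<F> :: "'b::infinite pair_pre_digraph set"
  assumes "simple_graph G" "\<forall>F\<in>\<F>. simple_graph F" "t \<ge> 1"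
  shows "isolation_number G (disjoint_copies t \<F>) \<le> isolation_number G \<F>"
proof -
  have "isolating_set \<F> G (pverts G)"
    using assms by (simp add: isolating_set_of_dominating closed_nbhd_verts simple_graph_wf)
  then obtain D where D: "isolating_set \<F> G D" "card D = isolation_number G \<F>"
    by (rule isolation_number_attained)
  then have "isolating_set (disjoint_copies t \<F>) G D"
    using assms family_packing_mono[of t \<F> G _ 1]
    unfolding isolating_set_iff[of \<F>]
      isolating_set_disjoint_copies_iff[OF simple_graph_finite[OF assms(1)]]
    by blast
  from isolation_number_le[OF this] show ?thesis
    by (simp add: D)
qed

text \<open>
  Induction on \<open>n\<close>: dominating one remaining family graph costs at most \<open>g\<close> vertices and lowers the
  number of disjoint family graphs that still fit by at least one, because that graph could be added
  to any packing found outside the enlarged closed neighbourhood.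
\<close>

lemma isolating_set_from_packing_bound:
  assumes "finite (pverts G)" "\<forall>F\<in>\<F>. domination_number F \<le> g"
    and "D \<subseteq> pverts G" "\<not> family_packing (Suc n) \<F> G (pverts G - closed_nbhd G D)"
  shows "\<exists>D'. isolating_set \<F> G D' \<and> card D' \<le> card D + n * g"
  using assms(3,4)
proof (induction n arbitrary: D)
  case 0
  then show ?case
    by (auto simp: isolating_set_iff)
next
  case (Suc n)
  let ?R = "\<lambda>D. pverts G - closed_nbhd G D"
  show ?case
  proof (cases "family_packing 1 \<F> G (?R D)")
    case False
    with Suc.prems(1) show ?thesis
      unfolding isolating_set_iff by (meson le_add1)
  next
    case True
    then obtain H where H: "is_family_graph \<F> H" "pverts H \<subseteq> ?R D" "parcs H \<subseteq> parcs G"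
      unfolding family_packing_one by blast
    obtain E where E: "E \<subseteq> pverts H" "pverts H \<subseteq> closed_nbhd H E" "card E \<le> g"
      using family_graph_dominating_set[OF H(1) assms(2)] .
    have "closed_nbhd H E \<subseteq> closed_nbhd G E"
      using H(3) unfolding closed_nbhd_def by blast
    then have "?R (D \<union> E) \<subseteq> ?R D - pverts H"
      using E(2) closed_nbhd_mono[of D "D \<union> E" G] closed_nbhd_mono[of E "D \<union> E" G] by blast
    then have "\<not> family_packing (Suc n) \<F> G (?R (D \<union> E))"
      using family_packing_Suc[OF H] Suc.prems(2) by blast
    moreover have "D \<union> E \<subseteq> pverts G"
      using Suc.prems(1) E(1) H(2) by blast
    ultimately obtain D' where "isolating_set \<F> G D'" "card D' \<le> card (D \<union> E) + n * g"
      using Suc.IH by blast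
    moreover have "card (D \<union> E) \<le> card D + g"
      using card_Un_le[of D E] E(3) by linarith
    ultimately show ?thesis
      by (intro exI[of _ D']) auto
  qed
qed

lemma isolation_number_le_disjoint_copies:
  fixes \<F> :: "'b::infinite pair_pre_digraph set"
  assumes G: "simple_graph G" and simp: "\<forall>F\<in>\<F>. simple_graph F"
    and g: "\<forall>F\<in>\<F>. domination_number F \<le> g"
  shows "isolation_number G \<F> \<le> isolation_number G (disjoint_copies (Suc n) \<F>) + n * g"
proof -
  have fin: "finite (pverts G)"
    using G by (rule simple_graph_finite)
  have "isolating_set \<F> G (pverts G)"
    using G simp by (simp add: isolating_set_of_dominating closed_nbhd_verts simple_graph_wf)
  then have "isolating_set (disjoint_copies (Suc n) \<F>) G (pverts G)"
    using family_packing_mono[of "Suc n" \<F> G _ 1]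
    unfolding isolating_set_iff[of \<F>] isolating_set_disjoint_copies_iff[OF fin] by auto
  then obtain D where D: "isolating_set (disjoint_copies (Suc n) \<F>) G D"
    "card D = isolation_number G (disjoint_copies (Suc n) \<F>)"
    by (rule isolation_number_attained)
  then obtain D' where "isolating_set \<F> G D'" "card D' \<le> card D + n * g"
    using isolating_set_from_packing_bound[OF fin g]
    unfolding isolating_set_disjoint_copies_iff[OF fin] by blast
  then show ?thesis
    using isolation_number_le D(2) by fastforce
qed

lemma domination_number_le_family_domination_number:
  assumes "has_max_domination_number \<F>" "F \<in> \<F>"
  shows "domination_number F \<le> family_domination_number \<F>"
proof -
  obtain b where "\<forall>F\<in>\<F>. domination_number F \<le> b"
    using assms(1) unfolding has_max_domination_number_def by blast
  then have "finite (domination_number ` \<F>)"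
    by (auto intro: finite_subset[of _ "{..b}"])
  then show ?thesis
    unfolding family_domination_number_def using assms(2) by simp
qed

section \<open>Disjoint unions of complete graphs\<close>

text \<open>
  The components are the intervals of \<open>p\<close> consecutive numbers, so that \<open>v div p\<close> is the component of \<open>v\<close>.
\<close>

definition disjoint_complete :: "nat \<Rightarrow> nat \<Rightarrow> nat pair_pre_digraph" where
  "disjoint_complete m p = \<lparr> pverts = {..<m * p},
    parcs = {(u, v). u < m * p \<and> v < m * p \<and> u \<noteq> v \<and> u div p = v div p} \<rparr>"

lemma simple_graph_disjoint_complete:
  assumes "m \<ge> 1" "p \<ge> 1"
  shows "simple_graph (disjoint_complete m p)"
proof -
  have "finite {(u, v). u < m * p \<and> v < m * p \<and> u \<noteq> v \<and> u div p = v div p}"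
    by (rule finite_subset[of _ "{..<m * p} \<times> {..<m * p}"]) auto
  then have "pair_graph (disjoint_complete m p)"
    by unfold_locales (auto simp: disjoint_complete_def symmetric_def sym_def)
  moreover have "0 \<in> pverts (disjoint_complete m p)"
    using assms by (simp add: disjoint_complete_def)
  ultimately show ?thesis
    unfolding simple_graph_def by blast
qed

lemma complete_graph_eq_disjoint_complete: "complete_graph k = disjoint_complete 1 k"
  by (auto simp: complete_graph_def disjoint_complete_def)

lemma closed_nbhd_disjoint_complete:
  assumes "D \<subseteq> {..<m * p}"
  shows "closed_nbhd (disjoint_complete m p) D = {v. v < m * p \<and> v div p \<in> (\<lambda>u. u div p) ` D}"
proof -
  have "v \<in> closed_nbhd (disjoint_complete m p) D \<longleftrightarrow>
      v < m * p \<and> (\<exists>u\<in>D. u div p = v div p)" for v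
    using assms by (cases "v \<in> D") (auto simp: closed_nbhd_def disjoint_complete_def)
  moreover have "v div p \<in> (\<lambda>u. u div p) ` D \<longleftrightarrow> (\<exists>u\<in>D. u div p = v div p)" for v
    by (metis (no_types, lifting) image_iff)
  ultimately show ?thesis
    by blast
qed

text \<open>
  Every vertex dominates its whole component, so one vertex per component removes \<open>d\<close> components at
  the least possible cost. This set attains both the domination and the isolation number.
\<close>

lemma closed_nbhd_initial_components:
  assumes "p \<ge> 1" "d \<le> m"
  shows "(\<lambda>i. i * p) ` {..<d} \<subseteq> {..<m * p}"
    and "closed_nbhd (disjoint_complete m p) ((\<lambda>i. i * p) ` {..<d}) = {..<d * p}"
    and "card ((\<lambda>i. i * p) ` {..<d}) = d"
proof -
  show sub: "(\<lambda>i. i * p) ` {..<d} \<subseteq> {..<m * p}"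
    using assms by auto
  have "(\<lambda>u. u div p) ` (\<lambda>i. i * p) ` {..<d} = {..<d}"
    using assms(1) by (simp add: image_image)
  moreover have "v < m * p" if "v < d * p" for v
    using that assms(2) by (meson mult_le_mono1 order_less_le_trans)
  ultimately show "closed_nbhd (disjoint_complete m p) ((\<lambda>i. i * p) ` {..<d}) = {..<d * p}"
    using assms(1) unfolding closed_nbhd_disjoint_complete[OF sub]
    by (auto simp: div_less_iff_less_mult)
  show "card ((\<lambda>i. i * p) ` {..<d}) = d"
    using assms(1) by (simp add: card_image inj_on_def)
qed

lemma domination_number_disjoint_complete:
  assumes "p \<ge> 1"
  shows "domination_number (disjoint_complete m p) = m"
proof (rule antisym)
  let ?U = "disjoint_complete m p"
  have verts: "pverts ?U = {..<m * p}"
    by (simp add: disjoint_complete_def)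
  show "domination_number ?U \<le> m"
    using domination_number_le[of _ ?U] closed_nbhd_initial_components[OF assms, of m m]
    by (metis order_refl verts)
  have "pair_wf_digraph ?U"
    by unfold_locales (auto simp: disjoint_complete_def)
  then obtain D where D: "D \<subseteq> pverts ?U" "closed_nbhd ?U D = pverts ?U"
    "card D = domination_number ?U"
    by (rule domination_number_attained)
  have "i \<in> (\<lambda>u. u div p) ` D" if "i < m" for i
  proof -
    have "i * p \<in> closed_nbhd ?U D"
      using D(2) that assms by (simp add: verts)
    then show ?thesis
      using D(1) assms by (simp add: closed_nbhd_disjoint_complete verts)
  qed
  moreover have "finite D"
    using D(1) finite_subset verts by auto
  ultimately have "card {..<m} \<le> card D"
    by (intro surj_card_le[where f = "\<lambda>u. u div p"]) auto
  then show "m \<le> domination_number ?U"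
    by (simp add: D(3))
qed

text \<open>
  Cut the vertices into blocks of \<open>k\<close> consecutive numbers; component \<open>i\<close> consists of the \<open>a\<close> blocks
  with index in \<open>{i * a..<i * a + a}\<close>. The blocks of the components that \<open>D\<close> misses give the packing.
\<close>

lemma family_packing_disjoint_complete:
  assumes "k \<ge> 1" "a \<ge> 1" and D: "D \<subseteq> {..<m * (a * k)}" and t: "t \<le> (m - card D) * a"
  shows "family_packing t {complete_graph k} (disjoint_complete m (a * k))
    (pverts (disjoint_complete m (a * k)) - closed_nbhd (disjoint_complete m (a * k)) D)"
proof -
  let ?U = "disjoint_complete m (a * k)"
  let ?C = "(\<lambda>u. u div (a * k)) ` D"
  define M where "M = {..<m} - ?C"
  have "finite D"
    using D finite_subset by blast
  then have "card ?C \<le> card D" "finite M"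
    by (auto simp: card_image_le M_def)
  moreover have "m - card ?C \<le> card M"
    using diff_card_le_card_Diff[of ?C "{..<m}"] \<open>finite D\<close> by (simp add: M_def)
  ultimately have "t \<le> card M * a"
    using t by (meson diff_le_mono2 le_trans mult_le_mono1)
  obtain e where e: "bij_betw e {..<card M} M"
    using ex_bij_betw_nat_finite[OF \<open>finite M\<close>] by (auto simp: atLeast0LessThan)
  \<comment> \<open>Block \<open>h s\<close> is the \<open>s mod a\<close>-th block of the missed component number \<open>s div a\<close>.\<close>
  define h where "h s = e (s div a) * a + s mod a" for s
  have "s div a < card M" if "s < t" for s
    using that \<open>t \<le> card M * a\<close> assms(2) by (simp add: div_less_iff_less_mult)
  then have h_div: "h s div a = e (s div a)" "e (s div a) \<in> M" if "s < t" for s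
    using that assms(2) e by (auto simp: h_def bij_betw_def)
  have h_mod: "h s mod a = s mod a" for s
    by (simp add: h_def)
  have h_inj: "s = s'" if "s < t" "s' < t" "h s = h s'" for s s'
  proof -
    have "e (s div a) = e (s' div a)" "s mod a = s' mod a"
      using that h_div h_mod by metis+
    moreover have "s div a < card M" "s' div a < card M"
      using that \<open>\<And>s. s < t \<Longrightarrow> s div a < card M\<close> by auto
    ultimately show ?thesis
      using e by (metis bij_betw_def inj_onD lessThan_iff div_mult_mod_eq)
  qed
  let ?H = "\<lambda>s. graph_image (\<lambda>x. h s * k + x) (complete_graph k)"
  have block: "v div k = h s" if "v \<in> pverts (?H s)" for v s
    using that assms(1) by (auto simp: complete_graph_def)
  have comp: "v div (a * k) = e (s div a)" "v < m * (a * k)"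
    if "v \<in> pverts (?H s)" "s < t" for v s
  proof -
    show *: "v div (a * k) = e (s div a)"
      using block[OF that(1)] h_div(1)[OF that(2)] by (simp add: mult.commute[of a] div_mult2_eq)
    have "e (s div a) < m"
      using h_div(2)[OF that(2)] by (simp add: M_def)
    then show "v < m * (a * k)"
      using assms(1,2) by (simp flip: * add: div_less_iff_less_mult)
  qed
  have "is_family_graph {complete_graph k} (?H s) \<and>
      pverts (?H s) \<subseteq> pverts ?U - closed_nbhd ?U D \<and> parcs (?H s) \<subseteq> parcs ?U" if "s < t" for s
  proof (intro conjI)
    have "simple_graph (complete_graph k)"
      using assms(1) by (simp add: complete_graph_eq_disjoint_complete simple_graph_disjoint_complete)
    then show "is_family_graph {complete_graph k} (?H s)"
      unfolding is_family_graph_iff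
      by (intro bexI[of _ "complete_graph k"] conjI exI[of _ "\<lambda>x. h s * k + x"])
        (auto simp: simple_graph_wf inj_on_def)
    have "v \<in> pverts ?U - closed_nbhd ?U D" if v: "v \<in> pverts (?H s)" for v
      using comp[OF v \<open>s < t\<close>] h_div(2)[OF \<open>s < t\<close>] unfolding closed_nbhd_disjoint_complete[OF D]
      by (simp add: disjoint_complete_def M_def)
    then show "pverts (?H s) \<subseteq> pverts ?U - closed_nbhd ?U D"
      by blast
    have "(u, v) \<in> parcs ?U" if uv: "(u, v) \<in> parcs (?H s)" for u v
    proof -
      have "u \<in> pverts (?H s)" "v \<in> pverts (?H s)" "u \<noteq> v"
        using uv by (auto simp: complete_graph_def)
      then show ?thesis
        using comp \<open>s < t\<close> by (simp add: disjoint_complete_def)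
    qed
    then show "parcs (?H s) \<subseteq> parcs ?U"
      by auto
  qed
  moreover have "pverts (?H s) \<inter> pverts (?H s') = {}" if "s < t" "s' < t" "s \<noteq> s'" for s s'
  proof (rule ccontr)
    assume "pverts (?H s) \<inter> pverts (?H s') \<noteq> {}"
    then obtain v where "v \<in> pverts (?H s)" "v \<in> pverts (?H s')"
      by (meson disjoint_iff)
    then have "h s = h s'"
      using block by metis
    with that h_inj show False
      by simp
  qed
  ultimately show ?thesis
    unfolding family_packing_def by (intro exI[of _ ?H] conjI allI impI) simp_all
qed

lemma family_packing_complete_graph_card:
  assumes "family_packing t {complete_graph k} G S" "finite S"
  shows "t * k \<le> card S"
proof -
  obtain H where
    H: "\<forall>i<t. is_family_graph {complete_graph k} (H i) \<and> pverts (H i) \<subseteq> S \<and> parcs (H i) \<subseteq> parcs G"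
    and disj: "\<forall>i<t. \<forall>j<t. i \<noteq> j \<longrightarrow> pverts (H i) \<inter> pverts (H j) = {}"
    using assms(1) unfolding family_packing_def by blast
  have "card (pverts (H i)) = k" if "i < t" for i
    using H that by (auto simp: is_family_graph_iff complete_graph_def card_image)
  moreover have "finite (pverts (H i))" if "i < t" for i
    using H that assms(2) finite_subset by blast
  ultimately have "card (\<Union>i<t. pverts (H i)) = t * k"
    using disj by (subst card_UN_disjoint) auto
  moreover have "(\<Union>i<t. pverts (H i)) \<subseteq> S"
    using H by blast
  ultimately show ?thesis
    using card_mono[OF assms(2)] by metis
qed

text \<open>
  Both bounds on \<open>\<iota>\<close> are counts: hitting \<open>d\<close> components leaves fewer than \<open>tk\<close> vertices, while fewer than
  \<open>d\<close> vertices miss enough components to leave \<open>t\<close> blocks of size \<open>k\<close>.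
\<close>

lemma isolation_number_disjoint_complete:
  assumes "k \<ge> 1" "a \<ge> 1" "d \<le> m"
    and upper: "(m - d) * a < t" and lower: "\<And>c. c < d \<Longrightarrow> t \<le> (m - c) * a"
  shows "isolation_number (disjoint_complete m (a * k)) (disjoint_copies t {complete_graph k}) = d"
proof -
  let ?U = "disjoint_complete m (a * k)" and ?D = "(\<lambda>i. i * (a * k)) ` {..<d}"
  have verts: "pverts ?U = {..<m * (a * k)}"
    by (simp add: disjoint_complete_def)
  then have fin: "finite (pverts ?U)"
    by simp
  note iso_iff = isolating_set_disjoint_copies_iff[OF fin, of t "{complete_graph k}"]
  have "a * k \<ge> 1"
    using assms(1,2) by simp
  note D = closed_nbhd_initial_components[OF this assms(3)]
  have "card (pverts ?U - closed_nbhd ?U ?D) = m * (a * k) - d * (a * k)"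
    unfolding D(2) verts using assms(3) by (subst card_Diff_subset) auto
  also have "\<dots> = (m - d) * a * k"
    by (simp add: diff_mult_distrib)
  also have "\<dots> < t * k"
    using upper assms(1) by simp
  finally have "\<not> family_packing t {complete_graph k} ?U (pverts ?U - closed_nbhd ?U ?D)"
    using family_packing_complete_graph_card fin by (metis finite_Diff not_less)
  then have iso: "isolating_set (disjoint_copies t {complete_graph k}) ?U ?D"
    using D(1) by (simp add: iso_iff verts)
  then obtain E where E: "isolating_set (disjoint_copies t {complete_graph k}) ?U E"
    "card E = isolation_number ?U (disjoint_copies t {complete_graph k})"
    by (rule isolation_number_attained)
  have "\<not> card E < d"
    using E(1) family_packing_disjoint_complete[OF assms(1,2), of E m t] lower
    unfolding iso_iff verts by blast
  then show ?thesis
    using isolation_number_le[OF iso] D(3) E(2) by simp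
qed

section \<open>Bounds and sharpness\<close>

theorem theorem6:
  fixes t :: nat
  assumes "t \<ge> 1"
  shows "(\<forall>(G :: 'a pair_pre_digraph) (\<F> :: 'b::infinite pair_pre_digraph set).
            simple_graph G \<longrightarrow> (\<forall>F\<in>\<F>. simple_graph F) \<longrightarrow>
              (has_max_domination_number \<F> \<longrightarrow>
                int (isolation_number G \<F>) - (int t - 1) * int (family_domination_number \<F>)
                  \<le> int (isolation_number G (disjoint_copies t \<F>))) \<and>
              isolation_number G (disjoint_copies t \<F>) \<le> isolation_number G \<F>) \<and>
         (\<forall>k\<ge>1. \<forall>q\<ge>1. \<exists>(G :: nat pair_pre_digraph) (H :: nat pair_pre_digraph).
            simple_graph G \<and> simple_graph H \<and>
            isolation_number G (disjoint_copies t {complete_graph k})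
              = isolation_number G {complete_graph k} \<and>
            isolation_number G {complete_graph k} = domination_number G \<and>
            domination_number G = q \<and>
            q = isolation_number H (disjoint_copies t {complete_graph k}) \<and>
            int (isolation_number H (disjoint_copies t {complete_graph k}))
              = int (isolation_number H {complete_graph k})
                - (int t - 1) * int (domination_number (complete_graph k)) \<and>
            isolation_number H {complete_graph k} = domination_number H)"
proof (intro conjI allI impI)
  fix G :: "'a pair_pre_digraph" and \<F> :: "'b pair_pre_digraph set"
  assume G: "simple_graph G" and \<F>: "\<forall>F\<in>\<F>. simple_graph F"
  show "isolation_number G (disjoint_copies t \<F>) \<le> isolation_number G \<F>"
    using G \<F> assms by (rule isolation_number_disjoint_copies_le)
  assume "has_max_domination_number \<F>"
  then have "\<forall>F\<in>\<F>. domination_number F \<le> family_domination_number \<F>"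
    by (simp add: domination_number_le_family_domination_number)
  from isolation_number_le_disjoint_copies[OF G \<F> this, of "t - 1"]
  have "int (isolation_number G \<F>) \<le>
      int (isolation_number G (disjoint_copies t \<F>) + (t - 1) * family_domination_number \<F>)"
    unfolding of_nat_le_iff using assms by simp
  then show "int (isolation_number G \<F>) - (int t - 1) * int (family_domination_number \<F>)
      \<le> int (isolation_number G (disjoint_copies t \<F>))"
    using assms by (simp add: of_nat_diff)
next
  fix k q :: nat
  assume k: "1 \<le> k" and q: "1 \<le> q"
  let ?K = "{complete_graph k}"
  let ?G = "disjoint_complete q (t * k)" and ?H = "disjoint_complete (q + t - 1) (1 * k)"
  have G: "simple_graph ?G" and H: "simple_graph ?H"
    using k q assms by (auto intro!: simple_graph_disjoint_complete)
  have K: "simple_graph (complete_graph k)" and dom_K: "domination_number (complete_graph k) = 1"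
    using k by (simp_all add: complete_graph_eq_disjoint_complete simple_graph_disjoint_complete
        domination_number_disjoint_complete)
  have dom_G: "domination_number ?G = q" and dom_H: "domination_number ?H = q + t - 1"
    using k assms by (auto intro!: domination_number_disjoint_complete)
  have G_t: "isolation_number ?G (disjoint_copies t ?K) = q"
  proof (rule isolation_number_disjoint_complete[OF k assms])
    fix c
    assume "c < q"
    then have "1 * t \<le> (q - c) * t"
      by (intro mult_le_mono1) simp
    then show "t \<le> (q - c) * t"
      by simp
  qed (use assms in auto)
  have G_1: "isolation_number ?G ?K = q"
    using isolation_number_disjoint_copies_le[OF G _ assms, of ?K]
      isolation_number_le_domination_number[OF G, of ?K] K by (simp add: G_t dom_G)
  have H_t: "isolation_number ?H (disjoint_copies t ?K) = q"
    using k q assms by (intro isolation_number_disjoint_complete) auto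
  have "isolation_number ?H (disjoint_copies 1 ?K) = q + t - 1"
    using k by (intro isolation_number_disjoint_complete) auto
  then have H_1: "isolation_number ?H ?K = q + t - 1"
    using isolation_number_disjoint_copies_one[OF simple_graph_finite[OF H]] by metis
  show "\<exists>(G :: nat pair_pre_digraph) (H :: nat pair_pre_digraph).
      simple_graph G \<and> simple_graph H \<and>
      isolation_number G (disjoint_copies t ?K) = isolation_number G ?K \<and>
      isolation_number G ?K = domination_number G \<and>
      domination_number G = q \<and>
      q = isolation_number H (disjoint_copies t ?K) \<and>
      int (isolation_number H (disjoint_copies t ?K))
        = int (isolation_number H ?K) - (int t - 1) * int (domination_number (complete_graph k)) \<and>
      isolation_number H ?K = domination_number H"
    by (rule exI[of _ ?G], rule exI[of _ ?H])
      (use assms q in \<open>simp only: G H G_t G_1 dom_G H_t H_1 dom_H dom_K, simp add: of_nat_diff\<close>)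
qed

end
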